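(* Let $K$ be a field. As a $2$-$As$ algebra over $K$, $(\mathcal{H}_{\mathcal{PP}},\rightsquigarrow,\natural)$ is freely generated by the set of nonempty $1,2$-indecomposable plane posets.
   Context: A double poset is a triple $(P,\leq_1,\leq_2)$ where $P$ is a finite set and $\leq_1,\leq_2$ are two partial orders on $P$. $\mathcal{DP}$ is the set of isomorphism classes of double posets (double posets are identified with their classes); the class of the empty double poset is denoted $1$. A plane poset is a double poset $(P,\leq_h,\leq_r)$ (with $\leq_h$ playing the role of $\leq_1$ and $\leq_r$ that of $\leq_2$) such that for all $x\neq y$ in $P$, $x$ and $y$ are comparable for $\leq_h$ if and only if they are not comparable for $\leq_r$. $\mathcal{PP}$ is the set of isomorphism classes of plane posets. For $P,Q\in\mathcal{DP}$: $P\rightsquigarrow Q$ is the disjoint union of $P$ and $Q$, with $P$ and $Q$ as double subposets, and for all $x\in P$, $y\in Q$: $x\leq_2 y$ and $x,y$ are not comparable for $\leq_1$. Similarly $P\natural Q$ is the disjoint union of $P$ and $Q$, with $P$ and $Q$ as double subposets, and for all $x\in P$, $y\in Q$: $x\leq_1 y$ and $x,y$ are not comparable for $\leq_2$. Both products are associative with unit $1$, and the products of plane posets are plane. $\mathcal{H}_{\mathcal{PP}}$ is the $K$-vector space with basis $\mathcal{PP}$, with $\rightsquigarrow$ and $\natural$ extended bilinearly. A $2$-$As$ algebra is a $K$-vector space with two associative products sharing the same unit; morphisms preserve both products and the unit; "freely generated by a set $S$" means that any map from $S$ to a $2$-$As$ algebra $A$ extends uniquely to a morphism of $2$-$As$ algebras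 to $A$. A double poset $P$ is $1$-indecomposable if the only subsets $I\subseteq P$ such that for all $x\in I$, $y\in P\setminus I$, $x\leq_2 y$ and $x,y$ are not $\leq_1$-comparable, are $I=\emptyset$ and $I=P$. It is $2$-indecomposable if the only subsets $I\subseteq P$ such that for all $x\in I$, $y\in P\setminus I$, $x\leq_1 y$ and $x,y$ are not $\leq_2$-comparable, are $I=\emptyset$ and $I=P$. It is $1,2$-indecomposable if it is both. *)

theory Defs
  imports Complex_Main "HOL-Library.Poly_Mapping" "HOL-Library.Nat_Bijection"
begin

section \<open>Double posets and plane posets\<close>

record 'a dposet =
  points :: "'a set"
  le1 :: "'a rel"
  le2 :: "'a rel"

definition double_poset :: "'a dposet \<Rightarrow> bool" where
  "double_poset P \<longleftrightarrow> finite (points P)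
     \<and> partial_order_on (points P) (le1 P) \<and> partial_order_on (points P) (le2 P)"

definition comparable :: "'a rel \<Rightarrow> 'a \<Rightarrow> 'a \<Rightarrow> bool" where
  "comparable R x y \<longleftrightarrow> (x, y) \<in> R \<or> (y, x) \<in> R"

definition plane_poset :: "'a dposet \<Rightarrow> bool" where
  "plane_poset P \<longleftrightarrow> double_poset P
     \<and> (\<forall>x\<in>points P. \<forall>y\<in>points P. x \<noteq> y \<longrightarrow>
          (comparable (le1 P) x y \<longleftrightarrow> \<not> comparable (le2 P) x y))"

definition dposet_iso :: "('a \<Rightarrow> 'b) \<Rightarrow> 'a dposet \<Rightarrow> 'b dposet \<Rightarrow> bool" where
  "dposet_iso f P Q \<longleftrightarrow> bij_betw f (points P) (points Q)
     \<and> (\<forall>x\<in>points P. \<forall>y\<in>points P. (x, y) \<in> le1 P \<longleftrightarrow> (f x, f y) \<in> le1 Q)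
     \<and> (\<forall>x\<in>points P. \<forall>y\<in>points P. (x, y) \<in> le2 P \<longleftrightarrow> (f x, f y) \<in> le2 Q)"

definition empty_dposet :: "'a dposet" where
  "empty_dposet = \<lparr>points = {}, le1 = {}, le2 = {}\<rparr>"

definition rel_disjoint_sum :: "'a rel \<Rightarrow> 'b rel \<Rightarrow> ('a + 'b) rel" where
  "rel_disjoint_sum R S =
     {(Inl x, Inl y) |x y. (x, y) \<in> R} \<union> {(Inr x, Inr y) |x y. (x, y) \<in> S}"

definition rel_ordinal_sum :: "'a set \<Rightarrow> 'b set \<Rightarrow> 'a rel \<Rightarrow> 'b rel \<Rightarrow> ('a + 'b) rel" where
  "rel_ordinal_sum A B R S = rel_disjoint_sum R S \<union> {(Inl x, Inr y) |x y. x \<in> A \<and> y \<in> B}"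

text \<open>\<open>compos1\<close> is the product written with a squiggly arrow, \<open>compos2\<close> the one written with
  a natural sign.\<close>

definition compos1 :: "'a dposet \<Rightarrow> 'b dposet \<Rightarrow> ('a + 'b) dposet" where
  "compos1 P Q =
     \<lparr>points = points P <+> points Q,
      le1 = rel_disjoint_sum (le1 P) (le1 Q),
      le2 = rel_ordinal_sum (points P) (points Q) (le2 P) (le2 Q)\<rparr>"

definition compos2 :: "'a dposet \<Rightarrow> 'b dposet \<Rightarrow> ('a + 'b) dposet" where
  "compos2 P Q =
     \<lparr>points = points P <+> points Q,
      le1 = rel_ordinal_sum (points P) (points Q) (le1 P) (le1 Q),
      le2 = rel_disjoint_sum (le2 P) (le2 Q)\<rparr>"

definition indecomposable1 :: "'a dposet \<Rightarrow> bool" where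
  "indecomposable1 P \<longleftrightarrow> (\<forall>I\<subseteq>points P.
     (\<forall>x\<in>I. \<forall>y\<in>points P - I. (x, y) \<in> le2 P \<and> \<not> comparable (le1 P) x y)
       \<longrightarrow> I = {} \<or> I = points P)"

definition indecomposable2 :: "'a dposet \<Rightarrow> bool" where
  "indecomposable2 P \<longleftrightarrow> (\<forall>I\<subseteq>points P.
     (\<forall>x\<in>I. \<forall>y\<in>points P - I. (x, y) \<in> le1 P \<and> \<not> comparable (le2 P) x y)
       \<longrightarrow> I = {} \<or> I = points P)"

definition dposet_rename :: "('a \<Rightarrow> 'b) \<Rightarrow> 'a dposet \<Rightarrow> 'b dposet" where
  "dposet_rename f P =
     \<lparr>points = f ` points P, le1 = map_prod f f ` le1 P, le2 = map_prod f f ` le2 P\<rparr>"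


subsection \<open>Invariance under isomorphism\<close>

lemma dposet_iso_id: "dposet_iso id P P"
  by (simp add: dposet_iso_def)

lemma dposet_iso_sym:
  assumes "dposet_iso f P Q"
  shows "dposet_iso (inv_into (points P) f) Q P"
proof -
  have b: "bij_betw f (points P) (points Q)" using assms by (simp add: dposet_iso_def)
  have 1: "f (inv_into (points P) f y) = y" "inv_into (points P) f y \<in> points P"
    if "y \<in> points Q" for y
    using b that by (auto simp: bij_betw_def f_inv_into_f inv_into_into)
  show ?thesis
    using assms 1 bij_betw_inv_into[OF b] unfolding dposet_iso_def by auto
qed

lemma dposet_iso_trans:
  assumes "dposet_iso f P Q" "dposet_iso g Q R"
  shows "dposet_iso (g \<circ> f) P R"
proof -
  have "f x \<in> points Q" if "x \<in> points P" for x
    using assms that by (auto simp: dposet_iso_def bij_betw_def)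
  then show ?thesis
    using assms bij_betw_trans[of f "points P" "points Q" g "points R"]
    unfolding dposet_iso_def by auto
qed

lemma plane_poset_iso:
  assumes "dposet_iso f P Q" "double_poset Q" "plane_poset P"
  shows "plane_poset Q"
  unfolding plane_poset_def
proof (intro conjI ballI impI)
  show "double_poset Q" by fact
  fix x y assume xy: "x \<in> points Q" "y \<in> points Q" "x \<noteq> y"
  have "f ` points P = points Q"
    using assms(1) by (simp add: dposet_iso_def bij_betw_def)
  with xy obtain a b where ab: "a \<in> points P" "b \<in> points P" "x = f a" "y = f b"
    by (metis imageE)
  have "a \<noteq> b" using xy ab by auto
  then have "comparable (le1 P) a b \<longleftrightarrow> \<not> comparable (le2 P) a b"
    using assms(3) ab(1,2) by (simp add: plane_poset_def)
  moreover have "comparable (le1 Q) x y \<longleftrightarrow> comparable (le1 P) a b"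
    "comparable (le2 Q) x y \<longleftrightarrow> comparable (le2 P) a b"
    using assms(1) ab by (simp_all add: dposet_iso_def comparable_def)
  ultimately show "comparable (le1 Q) x y \<longleftrightarrow> \<not> comparable (le2 Q) x y" by simp
qed

lemma indecomposable_iso:
  assumes "dposet_iso f P Q"
  shows "indecomposable1 P \<Longrightarrow> indecomposable1 Q"
    and "indecomposable2 P \<Longrightarrow> indecomposable2 Q"
proof -
  have inj: "inj_on f (points P)" and im: "f ` points P = points Q"
    using assms by (auto simp: dposet_iso_def bij_betw_def)
  have r: "x \<in> points P \<Longrightarrow> y \<in> points P \<Longrightarrow> (f x, f y) \<in> le1 Q \<longleftrightarrow> (x, y) \<in> le1 P"
    "x \<in> points P \<Longrightarrow> y \<in> points P \<Longrightarrow> (f x, f y) \<in> le2 Q \<longleftrightarrow> (x, y) \<in> le2 P" for x y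
    using assms by (auto simp: dposet_iso_def)
  have fI: "f ` {x \<in> points P. f x \<in> I} = I" if "I \<subseteq> points Q" for I
  proof
    show "I \<subseteq> f ` {x \<in> points P. f x \<in> I}"
    proof
      fix y assume "y \<in> I"
      then have "y \<in> f ` points P" using that im by (simp add: subset_iff)
      with \<open>y \<in> I\<close> show "y \<in> f ` {x \<in> points P. f x \<in> I}" by (elim imageE) simp
    qed
  qed (simp add: image_subset_iff)
  show "indecomposable1 Q" if ind: "indecomposable1 P"
    unfolding indecomposable1_def
  proof (intro allI impI)
    fix I assume I: "I \<subseteq> points Q" and
      d: "\<forall>x\<in>I. \<forall>y\<in>points Q - I. (x, y) \<in> le2 Q \<and> \<not> comparable (le1 Q) x y"
    let ?J = "{x \<in> points P. f x \<in> I}"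
    have "\<forall>x\<in>?J. \<forall>y\<in>points P - ?J. (x, y) \<in> le2 P \<and> \<not> comparable (le1 P) x y"
    proof (intro ballI)
      fix x y assume x: "x \<in> ?J" and y: "y \<in> points P - ?J"
      then have "f x \<in> I" "f y \<in> points Q - I" unfolding im[symmetric] by auto
      with d have "(f x, f y) \<in> le2 Q \<and> \<not> comparable (le1 Q) (f x) (f y)" by blast
      with x y show "(x, y) \<in> le2 P \<and> \<not> comparable (le1 P) x y"
        by (simp add: comparable_def r)
    qed
    moreover have "?J \<subseteq> points P" by blast
    ultimately have "?J = {} \<or> ?J = points P"
      using ind unfolding indecomposable1_def by blast
    then show "I = {} \<or> I = points Q" using fI[OF I] im by (elim disjE) simp_all
  qed
  show "indecomposable2 Q" if ind: "indecomposable2 P"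
    unfolding indecomposable2_def
  proof (intro allI impI)
    fix I assume I: "I \<subseteq> points Q" and
      d: "\<forall>x\<in>I. \<forall>y\<in>points Q - I. (x, y) \<in> le1 Q \<and> \<not> comparable (le2 Q) x y"
    let ?J = "{x \<in> points P. f x \<in> I}"
    have "\<forall>x\<in>?J. \<forall>y\<in>points P - ?J. (x, y) \<in> le1 P \<and> \<not> comparable (le2 P) x y"
    proof (intro ballI)
      fix x y assume x: "x \<in> ?J" and y: "y \<in> points P - ?J"
      then have "f x \<in> I" "f y \<in> points Q - I" unfolding im[symmetric] by auto
      with d have "(f x, f y) \<in> le1 Q \<and> \<not> comparable (le2 Q) (f x) (f y)" by blast
      with x y show "(x, y) \<in> le1 P \<and> \<not> comparable (le2 P) x y"
        by (simp add: comparable_def r)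
    qed
    moreover have "?J \<subseteq> points P" by blast
    ultimately have "?J = {} \<or> ?J = points P"
      using ind unfolding indecomposable2_def by blast
    then show "I = {} \<or> I = points Q" using fI[OF I] im by (elim disjE) simp_all
  qed
qed

lemma compos_iso:
  assumes "dposet_iso f P P'" "dposet_iso g Q Q'"
  shows "dposet_iso (map_sum f g) (compos1 P Q) (compos1 P' Q')"
    and "dposet_iso (map_sum f g) (compos2 P Q) (compos2 P' Q')"
proof -
  have i: "inj_on f (points P)" "inj_on g (points Q)"
    "f ` points P = points P'" "g ` points Q = points Q'"
    using assms by (auto simp: dposet_iso_def bij_betw_def)
  have m: "x \<in> points P \<Longrightarrow> f x \<in> points P'" "y \<in> points Q \<Longrightarrow> g y \<in> points Q'" for x y
    by (simp_all add: i(3,4)[symmetric])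
  have b: "bij_betw (map_sum f g) (points P <+> points Q) (points P' <+> points Q')"
    unfolding bij_betw_def
  proof
    show "inj_on (map_sum f g) (points P <+> points Q)"
      by (rule inj_onI) (elim PlusE; simp add: inj_on_eq_iff[OF i(1)] inj_on_eq_iff[OF i(2)])
    show "map_sum f g ` (points P <+> points Q) = points P' <+> points Q'"
      by (simp add: i(3,4)[symmetric] Plus_def image_Un image_image)
  qed
  have r:
    "x \<in> points P \<Longrightarrow> y \<in> points P \<Longrightarrow> (f x, f y) \<in> le1 P' \<longleftrightarrow> (x, y) \<in> le1 P"
    "x \<in> points P \<Longrightarrow> y \<in> points P \<Longrightarrow> (f x, f y) \<in> le2 P' \<longleftrightarrow> (x, y) \<in> le2 P"
    "z \<in> points Q \<Longrightarrow> w \<in> points Q \<Longrightarrow> (g z, g w) \<in> le1 Q' \<longleftrightarrow> (z, w) \<in> le1 Q"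
    "z \<in> points Q \<Longrightarrow> w \<in> points Q \<Longrightarrow> (g z, g w) \<in> le2 Q' \<longleftrightarrow> (z, w) \<in> le2 Q"
    for x y z w
    using assms by (simp_all add: dposet_iso_def)
  show "dposet_iso (map_sum f g) (compos1 P Q) (compos1 P' Q')"
    unfolding dposet_iso_def compos1_def
    by (simp add: b, intro conjI ballI; elim PlusE)
      (simp_all add: rel_disjoint_sum_def rel_ordinal_sum_def m r)
  show "dposet_iso (map_sum f g) (compos2 P Q) (compos2 P' Q')"
    unfolding dposet_iso_def compos2_def
    by (simp add: b, intro conjI ballI; elim PlusE)
      (simp_all add: rel_disjoint_sum_def rel_ordinal_sum_def m r)
qed

lemma partial_order_rel_sums:
  assumes "partial_order_on A R" "partial_order_on B S"
  shows "partial_order_on (A <+> B) (rel_disjoint_sum R S)"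
    and "partial_order_on (A <+> B) (rel_ordinal_sum A B R S)"
proof -
  note d = partial_order_on_def preorder_on_def
  have R: "R \<subseteq> A \<times> A" "refl_on A R" "trans R" "antisym R"
    and S: "S \<subseteq> B \<times> B" "refl_on B S" "trans S" "antisym S"
    using assms by (auto simp: d)
  show "partial_order_on (A <+> B) (rel_disjoint_sum R S)"
    unfolding d
  proof (intro conjI)
    show "rel_disjoint_sum R S \<subseteq> (A <+> B) \<times> (A <+> B)"
      using R S by (auto simp: rel_disjoint_sum_def)
    show "refl_on (A <+> B) (rel_disjoint_sum R S)"
      using R S by (auto simp: rel_disjoint_sum_def refl_on_def)
    show "trans (rel_disjoint_sum R S)"
      by (rule transI) (auto simp: rel_disjoint_sum_def intro: transD[OF R(3)] transD[OF S(3)])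
    show "antisym (rel_disjoint_sum R S)"
      by (rule antisymI) (auto simp: rel_disjoint_sum_def intro: antisymD[OF R(4)] antisymD[OF S(4)])
  qed
  show "partial_order_on (A <+> B) (rel_ordinal_sum A B R S)"
    unfolding d
  proof (intro conjI)
    show "rel_ordinal_sum A B R S \<subseteq> (A <+> B) \<times> (A <+> B)"
      using R S by (auto simp: rel_disjoint_sum_def rel_ordinal_sum_def)
    show "refl_on (A <+> B) (rel_ordinal_sum A B R S)"
      using R S by (auto simp: rel_disjoint_sum_def rel_ordinal_sum_def refl_on_def)
    show "trans (rel_ordinal_sum A B R S)"
      using R(1) S(1)
      by (intro transI)
         (auto simp: rel_disjoint_sum_def rel_ordinal_sum_def
           intro: transD[OF R(3)] transD[OF S(3)])
    show "antisym (rel_ordinal_sum A B R S)"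
      by (rule antisymI) (auto simp: rel_disjoint_sum_def rel_ordinal_sum_def
            intro: antisymD[OF R(4)] antisymD[OF S(4)])
  qed
qed

lemma double_poset_compos:
  assumes "double_poset P" "double_poset Q"
  shows "double_poset (compos1 P Q)" and "double_poset (compos2 P Q)"
  using assms partial_order_rel_sums
  unfolding double_poset_def compos1_def compos2_def by auto

lemma plane_poset_compos:
  assumes "plane_poset P" "plane_poset Q"
  shows "plane_poset (compos1 P Q)" and "plane_poset (compos2 P Q)"
proof -
  have D: "double_poset P" "double_poset Q" using assms by (auto simp: plane_poset_def)
  have r:
    "x \<in> points P \<Longrightarrow> y \<in> points P \<Longrightarrow> x \<noteq> y \<Longrightarrow>
      ((x, y) \<in> le1 P \<or> (y, x) \<in> le1 P) \<longleftrightarrow> \<not> ((x, y) \<in> le2 P \<or> (y, x) \<in> le2 P)"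
    "z \<in> points Q \<Longrightarrow> w \<in> points Q \<Longrightarrow> z \<noteq> w \<Longrightarrow>
      ((z, w) \<in> le1 Q \<or> (w, z) \<in> le1 Q) \<longleftrightarrow> \<not> ((z, w) \<in> le2 Q \<or> (w, z) \<in> le2 Q)"
    for x y z w
    using assms by (simp_all add: plane_poset_def comparable_def)
  note d = compos1_def compos2_def comparable_def rel_disjoint_sum_def rel_ordinal_sum_def
  show "plane_poset (compos1 P Q)"
    unfolding plane_poset_def
  proof (intro conjI ballI impI)
    show "double_poset (compos1 P Q)" by (rule double_poset_compos(1)[OF D])
    fix x y assume "x \<in> points (compos1 P Q)" "y \<in> points (compos1 P Q)" "x \<noteq> y"
    then have xy: "x \<in> points P <+> points Q" "y \<in> points P <+> points Q" "x \<noteq> y"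
      by (simp_all add: compos1_def)
    then show "comparable (le1 (compos1 P Q)) x y \<longleftrightarrow> \<not> comparable (le2 (compos1 P Q)) x y"
      by (elim PlusE) (simp_all add: d r)
  qed
  show "plane_poset (compos2 P Q)"
    unfolding plane_poset_def
  proof (intro conjI ballI impI)
    show "double_poset (compos2 P Q)" by (rule double_poset_compos(2)[OF D])
    fix x y assume "x \<in> points (compos2 P Q)" "y \<in> points (compos2 P Q)" "x \<noteq> y"
    then have xy: "x \<in> points P <+> points Q" "y \<in> points P <+> points Q" "x \<noteq> y"
      by (simp_all add: compos2_def)
    then show "comparable (le1 (compos2 P Q)) x y \<longleftrightarrow> \<not> comparable (le2 (compos2 P Q)) x y"
      by (elim PlusE) (simp_all add: d r)
  qed
qed

lemma dposet_iso_rename: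
  assumes "inj f"
  shows "dposet_iso f P (dposet_rename f P)"
proof -
  have "(f x, f y) \<in> map_prod f f ` R \<longleftrightarrow> (x, y) \<in> R" for x y and R :: "'a rel"
  proof
    assume "(f x, f y) \<in> map_prod f f ` R"
    then obtain a b where "(a, b) \<in> R" "f x = f a" "f y = f b" by auto
    then show "(x, y) \<in> R" using assms by (simp add: inj_eq)
  next
    assume "(x, y) \<in> R"
    then show "(f x, f y) \<in> map_prod f f ` R" by (rule map_prod_imageI)
  qed
  moreover have "bij_betw f (points P) (f ` points P)"
    using assms by (intro inj_on_imp_bij_betw inj_on_subset[OF assms]) simp
  ultimately show ?thesis by (simp add: dposet_iso_def dposet_rename_def)
qed

lemma double_poset_rename:
  assumes "inj f" "double_poset P"
  shows "double_poset (dposet_rename f P)"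
proof -
  have "partial_order_on (f ` A) (map_prod f f ` R)" if p: "partial_order_on A R"
    for A and R :: "'a rel"
  proof -
    have R: "R \<subseteq> A \<times> A" "refl_on A R" "trans R" "antisym R"
      using p by (auto simp: partial_order_on_def preorder_on_def)
    show ?thesis
      unfolding partial_order_on_def preorder_on_def
    proof (intro conjI)
      show "map_prod f f ` R \<subseteq> f ` A \<times> f ` A" using R(1) by auto
      show "refl_on (f ` A) (map_prod f f ` R)"
        using R(2) by (auto simp: refl_on_def intro: map_prod_imageI)
      show "trans (map_prod f f ` R)"
      proof (rule transI)
        fix x y z assume "(x, y) \<in> map_prod f f ` R" "(y, z) \<in> map_prod f f ` R"
        then obtain a b c d where "(a, b) \<in> R" "(c, d) \<in> R" "x = f a" "y = f b" "y = f c" "z = f d"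
          by auto
        with assms(1) have "(a, d) \<in> R" by (metis R(3) transD inj_eq)
        with \<open>x = f a\<close> \<open>z = f d\<close> show "(x, z) \<in> map_prod f f ` R"
          by (simp add: map_prod_imageI)
      qed
      show "antisym (map_prod f f ` R)"
      proof (rule antisymI)
        fix x y assume "(x, y) \<in> map_prod f f ` R" "(y, x) \<in> map_prod f f ` R"
        then obtain a b c d where "(a, b) \<in> R" "(c, d) \<in> R" "x = f a" "y = f b" "y = f c" "x = f d"
          by auto
        with assms(1) show "x = y" by (metis R(4) antisymD inj_eq)
      qed
    qed
  qed
  then show ?thesis using assms(2) by (simp add: double_poset_def dposet_rename_def)
qed


section \<open>Isomorphism classes\<close>

text \<open>Every finite double poset is isomorphic to one whose points are natural numbers, so
  isomorphism classes are formed from double posets over \<open>nat\<close>; \<open>sum_encode\<close> brings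
  a disjoint union back into \<open>nat\<close>.\<close>

definition dposet_equiv :: "nat dposet \<Rightarrow> nat dposet \<Rightarrow> bool" where
  "dposet_equiv P Q \<longleftrightarrow> double_poset P \<and> double_poset Q \<and> (\<exists>f. dposet_iso f P Q)"

lemma double_poset_empty: "double_poset empty_dposet"
  by (simp add: double_poset_def empty_dposet_def partial_order_on_def preorder_on_def refl_on_def)

quotient_type dposet_class = "nat dposet" / partial: dposet_equiv
proof (rule part_equivpI)
  show "\<exists>P. dposet_equiv P P"
    using double_poset_empty dposet_iso_id by (auto simp: dposet_equiv_def)
  show "symp dposet_equiv"
    by (rule sympI) (auto simp: dposet_equiv_def dest: dposet_iso_sym)
  show "transp dposet_equiv"
    by (rule transpI) (use dposet_iso_trans in \<open>unfold dposet_equiv_def, blast\<close>)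
qed

lemma dposet_equiv_compos:
  assumes "dposet_equiv P P'" "dposet_equiv Q Q'"
  shows "dposet_equiv (dposet_rename sum_encode (compos1 P Q)) (dposet_rename sum_encode (compos1 P' Q'))"
    and "dposet_equiv (dposet_rename sum_encode (compos2 P Q)) (dposet_rename sum_encode (compos2 P' Q'))"
proof -
  have inj: "inj sum_encode" by (rule inj_sum_encode)
  obtain f g where fg: "dposet_iso f P P'" "dposet_iso g Q Q'"
    using assms by (auto simp: dposet_equiv_def)
  have D: "double_poset P" "double_poset P'" "double_poset Q" "double_poset Q'"
    using assms by (auto simp: dposet_equiv_def)
  have *: "\<exists>h. dposet_iso h (dposet_rename sum_encode X) (dposet_rename sum_encode Y)"
    if "dposet_iso k X Y" for X Y :: "(nat + nat) dposet" and k
    using dposet_iso_trans[OF dposet_iso_trans[OF dposet_iso_sym[OF dposet_iso_rename[OF inj]] that]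
        dposet_iso_rename[OF inj]] by blast
  show "dposet_equiv (dposet_rename sum_encode (compos1 P Q)) (dposet_rename sum_encode (compos1 P' Q'))"
    using *[OF compos_iso(1)[OF fg]] double_poset_rename[OF inj] double_poset_compos(1) D
    by (auto simp: dposet_equiv_def)
  show "dposet_equiv (dposet_rename sum_encode (compos2 P Q)) (dposet_rename sum_encode (compos2 P' Q'))"
    using *[OF compos_iso(2)[OF fg]] double_poset_rename[OF inj] double_poset_compos(2) D
    by (auto simp: dposet_equiv_def)
qed

lift_definition empty_class :: dposet_class is empty_dposet
  using double_poset_empty dposet_iso_id by (auto simp: dposet_equiv_def)

lift_definition compos1_class :: "dposet_class \<Rightarrow> dposet_class \<Rightarrow> dposet_class"
  is "\<lambda>P Q. dposet_rename sum_encode (compos1 P Q)"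
  by (rule dposet_equiv_compos(1))

lift_definition compos2_class :: "dposet_class \<Rightarrow> dposet_class \<Rightarrow> dposet_class"
  is "\<lambda>P Q. dposet_rename sum_encode (compos2 P Q)"
  by (rule dposet_equiv_compos(2))

lift_definition plane_class :: "dposet_class \<Rightarrow> bool" is plane_poset
  using plane_poset_iso dposet_iso_sym unfolding dposet_equiv_def by blast

lift_definition indecomposable1_class :: "dposet_class \<Rightarrow> bool" is indecomposable1
  using indecomposable_iso(1) dposet_iso_sym unfolding dposet_equiv_def by blast

lift_definition indecomposable2_class :: "dposet_class \<Rightarrow> bool" is indecomposable2
  using indecomposable_iso(2) dposet_iso_sym unfolding dposet_equiv_def by blast

lemma plane_poset_rename:
  assumes "inj f" "plane_poset P"
  shows "plane_poset (dposet_rename f P)"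
  using plane_poset_iso[OF dposet_iso_rename[OF assms(1)] double_poset_rename[OF assms(1)] assms(2)]
    assms(2) by (simp add: plane_poset_def)

lemma plane_class_empty: "plane_class empty_class"
  by transfer (simp add: plane_poset_def double_poset_empty, simp add: empty_dposet_def)

lemma plane_class_compos1:
  "plane_class P \<Longrightarrow> plane_class Q \<Longrightarrow> plane_class (compos1_class P Q)"
  by transfer (simp add: plane_poset_rename plane_poset_compos inj_sum_encode)

lemma plane_class_compos2:
  "plane_class P \<Longrightarrow> plane_class Q \<Longrightarrow> plane_class (compos2_class P Q)"
  by transfer (simp add: plane_poset_rename plane_poset_compos inj_sum_encode)

typedef plane_pos = "{P. plane_class P}" morphisms class_of_plane Abs_plane_pos
  using plane_class_empty by auto

setup_lifting type_definition_plane_pos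

lift_definition pp_one :: plane_pos is empty_class by (rule plane_class_empty)

lift_definition pp_compos1 :: "plane_pos \<Rightarrow> plane_pos \<Rightarrow> plane_pos" is compos1_class
  by (rule plane_class_compos1)

lift_definition pp_compos2 :: "plane_pos \<Rightarrow> plane_pos \<Rightarrow> plane_pos" is compos2_class
  by (rule plane_class_compos2)

definition indecomposable12 :: "plane_pos \<Rightarrow> bool" where
  "indecomposable12 P \<longleftrightarrow>
     indecomposable1_class (class_of_plane P) \<and> indecomposable2_class (class_of_plane P)"


section \<open>2-As algebras\<close>

locale two_As_algebra = vector_space scale
  for scale :: "'k::field \<Rightarrow> 'a::ab_group_add \<Rightarrow> 'a" +
  fixes m1 m2 :: "'a \<Rightarrow> 'a \<Rightarrow> 'a" and unit :: 'a
  assumes m1_linear_left: "Vector_Spaces.linear scale scale (\<lambda>x. m1 x y)"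
    and m1_linear_right: "Vector_Spaces.linear scale scale (\<lambda>y. m1 x y)"
    and m1_assoc: "m1 (m1 x y) z = m1 x (m1 y z)"
    and m1_unit: "m1 unit x = x" "m1 x unit = x"
    and m2_linear_left: "Vector_Spaces.linear scale scale (\<lambda>x. m2 x y)"
    and m2_linear_right: "Vector_Spaces.linear scale scale (\<lambda>y. m2 x y)"
    and m2_assoc: "m2 (m2 x y) z = m2 x (m2 y z)"
    and m2_unit: "m2 unit x = x" "m2 x unit = x"

definition two_As_morphism ::
  "('k::field \<Rightarrow> 'a::ab_group_add \<Rightarrow> 'a) \<Rightarrow> ('a \<Rightarrow> 'a \<Rightarrow> 'a) \<Rightarrow> ('a \<Rightarrow> 'a \<Rightarrow> 'a) \<Rightarrow> 'a \<Rightarrow>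
   ('k \<Rightarrow> 'b::ab_group_add \<Rightarrow> 'b) \<Rightarrow> ('b \<Rightarrow> 'b \<Rightarrow> 'b) \<Rightarrow> ('b \<Rightarrow> 'b \<Rightarrow> 'b) \<Rightarrow> 'b \<Rightarrow>
   ('a \<Rightarrow> 'b) \<Rightarrow> bool" where
  "two_As_morphism sA mA1 mA2 uA sB mB1 mB2 uB \<phi> \<longleftrightarrow>
     Vector_Spaces.linear sA sB \<phi>
     \<and> (\<forall>x y. \<phi> (mA1 x y) = mB1 (\<phi> x) (\<phi> y))
     \<and> (\<forall>x y. \<phi> (mA2 x y) = mB2 (\<phi> x) (\<phi> y))
     \<and> \<phi> uA = uB"

text \<open>A definition cannot quantify over types, so the type \<open>'b\<close> carrying the target algebras is
  a parameter; the universal property ranges over all 2-As algebras once \<open>'b\<close> is an arbitrary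
  type variable. Only the values of \<open>f\<close> on \<open>S\<close> matter.\<close>

definition freely_generated_two_As ::
  "'b::ab_group_add itself \<Rightarrow>
   ('k::field \<Rightarrow> 'a::ab_group_add \<Rightarrow> 'a) \<Rightarrow> ('a \<Rightarrow> 'a \<Rightarrow> 'a) \<Rightarrow> ('a \<Rightarrow> 'a \<Rightarrow> 'a) \<Rightarrow> 'a \<Rightarrow>
   'a set \<Rightarrow> bool" where
  "freely_generated_two_As _ s m1 m2 u S \<longleftrightarrow>
     two_As_algebra s m1 m2 u
     \<and> (\<forall>(sB :: 'k \<Rightarrow> 'b \<Rightarrow> 'b) mB1 mB2 uB (f :: 'a \<Rightarrow> 'b).
          two_As_algebra sB mB1 mB2 uB \<longrightarrow>
          (\<exists>!\<phi>. two_As_morphism s m1 m2 u sB mB1 mB2 uB \<phi> \<and> (\<forall>x\<in>S. \<phi> x = f x)))"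


section \<open>The algebra of plane posets\<close>

type_synonym 'k H_PP = "plane_pos \<Rightarrow>\<^sub>0 'k"

definition H_scale :: "'k::field \<Rightarrow> 'k H_PP \<Rightarrow> 'k H_PP" where
  "H_scale c = Poly_Mapping.map ((*) c)"

definition H_basis :: "plane_pos \<Rightarrow> 'k::field H_PP" where
  "H_basis P = Poly_Mapping.single P 1"

definition bilinear_extension ::
  "(plane_pos \<Rightarrow> plane_pos \<Rightarrow> plane_pos) \<Rightarrow> 'k::field H_PP \<Rightarrow> 'k H_PP \<Rightarrow> 'k H_PP" where
  "bilinear_extension op x y =
     (\<Sum>P\<in>Poly_Mapping.keys x. \<Sum>Q\<in>Poly_Mapping.keys y.
        Poly_Mapping.single (op P Q) (Poly_Mapping.lookup x P * Poly_Mapping.lookup y Q))"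

definition H_compos1 :: "'k::field H_PP \<Rightarrow> 'k H_PP \<Rightarrow> 'k H_PP" where
  "H_compos1 = bilinear_extension pp_compos1"

definition H_compos2 :: "'k::field H_PP \<Rightarrow> 'k H_PP \<Rightarrow> 'k H_PP" where
  "H_compos2 = bilinear_extension pp_compos2"

end

theory Submission
  imports Defs
begin

text \<open>Under each of the two products the isomorphism classes of plane posets form a free monoid. Factorisations
of a plane poset \<open>X\<close> into two factors correspond to its \<^emph>\<open>cuts\<close>: the sets \<open>I\<close> of points such that every
point of \<open>I\<close> lies before every point outside \<open>I\<close> in the order belonging to the product
(\<open>pp_compos_iff_cut\<close>). Since no two points can each lie before the other, the cuts of \<open>X\<close> form a chain
under inclusion (\<open>is_cut_chain\<close>), so any two factorisations have a common refinement. This is Levi's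
equidivisibility property, and with the additive size it makes the first irreducible factor, hence the
whole factorisation into irreducibles, unique (\<open>irreducible_left_factor_unique\<close>).

The two products do not interfere: no class is a product of two nontrivial classes in both ways. Indeed
two points separated by a proper cut of one kind are comparable for exactly one of the orders, so a
proper cut of the other kind cannot separate them; but all points on one side of a proper cut of the
first kind would then have to stay together with all points on its other side, leaving nothing for the
second cut to separate. Therefore a class different from \<open>1\<close> is decomposable for at most one of
the products, and it is obtained from the common irreducibles by applying the two products in an
essentially unique way. Recursion along this decomposition gives, for any target with two associative
products sharing a unit, exactly one map with prescribed values on the common irreducibles that
respects both products and the unit (\<open>free_on_common_irreducibles\<close>, \<open>generated_by_common_irreducibles\<close>).

The irreducibles are exactly the nonempty indecomposable classes (\<open>indecomposable12_iff\<close>), and the products of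
the algebra are the bilinear extensions of the products of classes. The linear extension of a
map that is multiplicative on the basis is multiplicative, so the universal property passes from the
classes to the algebra.\<close>
section \<open>Graded monoids with unique factorisation\<close>

text \<open>Equidivisibility is Levi's condition: two factorisations of one element have a common refinement. A
graded monoid with this property is free on its irreducible elements; below, freeness is used in the
form of a unique first irreducible factor \<open>head\<close> with a unique cofactor \<open>tail\<close>.\<close>
locale equidivisible_monoid =
  fixes mul :: "'p \<Rightarrow> 'p \<Rightarrow> 'p" (infixl "\<cdot>" 70) and one :: 'p and weight :: "'p \<Rightarrow> nat"
  assumes mul_assoc: "(P \<cdot> Q) \<cdot> R = P \<cdot> (Q \<cdot> R)"
    and mul_one: "one \<cdot> P = P" "P \<cdot> one = P"
    and weight_mul: "weight (P \<cdot> Q) = weight P + weight Q"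
    and weight_eq_0: "weight P = 0 \<longleftrightarrow> P = one"
    and equidivisible: "A \<cdot> B = C \<cdot> D \<Longrightarrow> weight A \<le> weight C \<Longrightarrow> \<exists>E. C = A \<cdot> E \<and> B = E \<cdot> D"
begin

definition irreducible :: "'p \<Rightarrow> bool" where
  "irreducible P \<longleftrightarrow> P \<noteq> one \<and> (\<forall>A B. P = A \<cdot> B \<longrightarrow> A = one \<or> B = one)"

lemma mul_eq_one: "P \<cdot> Q = one \<longleftrightarrow> P = one \<and> Q = one"
  by (metis add_is_0 weight_eq_0 weight_mul)

lemma ex_irreducible_left_factor:
  assumes "P \<noteq> one"
  shows "\<exists>A B. irreducible A \<and> P = A \<cdot> B"
  using assms
proof (induction "weight P" arbitrary: P rule: less_induct)
  case less
  show ?case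
  proof (cases "irreducible P")
    case True
    then show ?thesis using mul_one(2) by metis
  next
    case False
    with less.prems obtain C D where CD: "P = C \<cdot> D" "C \<noteq> one" "D \<noteq> one"
      by (auto simp: irreducible_def)
    then have "weight C < weight P" by (simp add: weight_mul zero_less_iff_neq_zero weight_eq_0)
    with less.hyps CD(2) obtain A B where "irreducible A" "C = A \<cdot> B" by blast
    with CD(1) show ?thesis by (metis mul_assoc)
  qed
qed

text \<open>The common refinement splits the larger of \<open>A\<close> and \<open>C\<close> as the smaller one times some \<open>E\<close>;
irreducibility leaves only \<open>E = one\<close>.\<close>
lemma irreducible_left_factor_unique:
  assumes eq: "A \<cdot> B = C \<cdot> D" and irr: "irreducible A" "irreducible C"
  shows "A = C \<and> B = D"
proof -
  have *: "A = C \<and> B = D"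
    if prods: "A \<cdot> B = C \<cdot> D" and irr: "irreducible A" "irreducible C"
      and le: "weight A \<le> weight C" for A B C D
  proof -
    obtain E where "C = A \<cdot> E" "B = E \<cdot> D" using equidivisible[OF prods le] by blast
    moreover from this(1) irr have "E = one" by (auto simp: irreducible_def)
    ultimately show ?thesis by (simp add: mul_one)
  qed
  show ?thesis
    using *[OF eq irr] *[OF eq[symmetric] irr(2,1)] by (metis nat_le_linear)
qed

definition head :: "'p \<Rightarrow> 'p" where
  "head P = (SOME A. irreducible A \<and> (\<exists>B. P = A \<cdot> B))"

definition tail :: "'p \<Rightarrow> 'p" where
  "tail P = (SOME B. P = head P \<cdot> B)"

lemma head_tail:
  assumes "P \<noteq> one"
  shows "irreducible (head P)" "P = head P \<cdot> tail P"
proof -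
  have "\<exists>A. irreducible A \<and> (\<exists>B. P = A \<cdot> B)"
    using ex_irreducible_left_factor[OF assms] by blast
  then have *: "irreducible (head P) \<and> (\<exists>B. P = head P \<cdot> B)"
    unfolding head_def by (rule someI_ex)
  then show "irreducible (head P)" by blast
  from * have "\<exists>B. P = head P \<cdot> B" by blast
  then show "P = head P \<cdot> tail P"
    unfolding tail_def by (rule someI_ex)
qed

lemma head_tail_mul:
  assumes "irreducible A"
  shows "head (A \<cdot> B) = A" "tail (A \<cdot> B) = B"
proof -
  have "A \<cdot> B \<noteq> one" using assms by (simp add: mul_eq_one irreducible_def)
  from head_tail[OF this] assms show "head (A \<cdot> B) = A" "tail (A \<cdot> B) = B"
    using irreducible_left_factor_unique by metis+
qed

lemma weight_head_tail:
  assumes "P \<noteq> one" "\<not> irreducible P"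
  shows "weight (head P) < weight P" "weight (tail P) < weight P"
proof -
  note ht = head_tail[OF assms(1)]
  have "head P \<noteq> one" using ht(1) by (simp add: irreducible_def)
  moreover have "tail P \<noteq> one" using ht assms(2) by (metis mul_one(2))
  moreover have "weight P = weight (head P) + weight (tail P)"
    using ht(2) weight_mul by metis
  ultimately show "weight (head P) < weight P" "weight (tail P) < weight P"
    by (simp_all add: weight_eq_0[symmetric])
qed

text \<open>A map defined by recursion on \<open>head\<close> and \<open>tail\<close> is a homomorphism, because the head of a product
\<open>P \<cdot> Q\<close> is the head of \<open>P\<close> and its tail is the tail of \<open>P\<close> times \<open>Q\<close>.\<close>
lemma multiplicative_if_head_tail:
  assumes m_assoc: "\<And>x y z. m (m x y) z = m x (m y z)"
    and m_unit: "\<And>x. m u x = x" "\<And>x. m x u = x"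
    and g_one: "g one = u"
    and g_step: "\<And>P. P \<noteq> one \<Longrightarrow> \<not> irreducible P \<Longrightarrow> g P = m (g (head P)) (g (tail P))"
  shows "g (P \<cdot> Q) = m (g P) (g Q)"
proof (induction "weight P" arbitrary: P rule: less_induct)
  case less
  show ?case
  proof (cases "P = one \<or> Q = one")
    case True
    then show ?thesis by (auto simp: g_one m_unit mul_one)
  next
    case False
    then have PQ: "P \<cdot> Q \<noteq> one" "\<not> irreducible (P \<cdot> Q)"
      by (auto simp: mul_eq_one irreducible_def)
    show ?thesis
    proof (cases "irreducible P")
      case True
      then show ?thesis using g_step[OF PQ] by (simp add: head_tail_mul)
    next
      case red: False
      let ?h = "head P" and ?t = "tail P"
      have ht: "irreducible ?h" "P = ?h \<cdot> ?t" using head_tail False by blast+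
      have eq: "P \<cdot> Q = ?h \<cdot> (?t \<cdot> Q)" using ht(2) mul_assoc by metis
      have "g (P \<cdot> Q) = m (g ?h) (g (?t \<cdot> Q))"
        using g_step[OF PQ] head_tail_mul[OF ht(1), of "?t \<cdot> Q"] unfolding eq by simp
      also have "\<dots> = m (m (g ?h) (g ?t)) (g Q)"
        using less.hyps weight_head_tail(2) red False by (simp add: m_assoc)
      also have "m (g ?h) (g ?t) = g P" using g_step red False by simp
      finally show ?thesis .
    qed
  qed
qed

end

text \<open>The condition \<open>mixed\<close> forbids an element to be a proper product for both multiplications. It makes the
recursion that evaluates an element in another algebra with two products unambiguous.\<close>
locale two_equidivisible_monoids =
  M1: equidivisible_monoid mul1 one weight + M2: equidivisible_monoid mul2 one weight
  for mul1 mul2 :: "'p \<Rightarrow> 'p \<Rightarrow> 'p" and one weight +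
  assumes mixed: "mul1 A B = mul2 C D \<Longrightarrow> A = one \<or> B = one \<or> C = one \<or> D = one"
begin

lemma irreducible1_or_irreducible2:
  assumes "P \<noteq> one"
  shows "M1.irreducible P \<or> M2.irreducible P"
  using assms mixed unfolding M1.irreducible_def M2.irreducible_def by metis

text \<open>By \<open>mixed\<close>, at most one of the two tests for reducibility succeeds for \<open>P \<noteq> one\<close>. The recursion
therefore treats both multiplications symmetrically, and both arguments of a recursive call have smaller
weight because a reducible element has a nontrivial tail.\<close>
function eval :: "'b \<Rightarrow> ('b \<Rightarrow> 'b \<Rightarrow> 'b) \<Rightarrow> ('b \<Rightarrow> 'b \<Rightarrow> 'b) \<Rightarrow> ('p \<Rightarrow> 'b) \<Rightarrow> 'p \<Rightarrow> 'b" where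
  "eval u m1 m2 f P =
    (if P = one then u
     else if \<not> M1.irreducible P
       then m1 (eval u m1 m2 f (M1.head P)) (eval u m1 m2 f (M1.tail P))
     else if \<not> M2.irreducible P
       then m2 (eval u m1 m2 f (M2.head P)) (eval u m1 m2 f (M2.tail P))
     else f P)"
  by auto
termination
  by (relation "measure (\<lambda>(u, m1, m2, f, P). weight P)")
    (simp_all add: M1.weight_head_tail M2.weight_head_tail)

declare eval.simps [simp del]

text \<open>For the second multiplication the recursion equation on reducible elements holds because these
are irreducible for the first one, so that the first test in \<open>eval\<close> fails.\<close>
theorem free_on_common_irreducibles:
  assumes "\<And>x y z. m1 (m1 x y) z = m1 x (m1 y z)" "\<And>x. m1 u x = x" "\<And>x. m1 x u = x"
    and "\<And>x y z. m2 (m2 x y) z = m2 x (m2 y z)" "\<And>x. m2 u x = x" "\<And>x. m2 x u = x"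
  shows "\<exists>g. g one = u \<and> (\<forall>P Q. g (mul1 P Q) = m1 (g P) (g Q))
    \<and> (\<forall>P Q. g (mul2 P Q) = m2 (g P) (g Q))
    \<and> (\<forall>P. M1.irreducible P \<and> M2.irreducible P \<longrightarrow> g P = f P)"
proof -
  let ?g = "eval u m1 m2 f"
  have one: "?g one = u" by (simp add: eval.simps)
  have mul1: "?g (mul1 P Q) = m1 (?g P) (?g Q)" for P Q
    by (rule M1.multiplicative_if_head_tail[where g = ?g, OF assms(1-3) one]) (simp add: eval.simps)
  have "?g P = m2 (?g (M2.head P)) (?g (M2.tail P))"
    if "P \<noteq> one" "\<not> M2.irreducible P" for P
    using that irreducible1_or_irreducible2[OF that(1)] by (subst eval.simps) simp
  then have mul2: "?g (mul2 P Q) = m2 (?g P) (?g Q)" for P Q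
    by (rule M2.multiplicative_if_head_tail[where g = ?g, OF assms(4-6) one])
  have "?g P = f P" if "M1.irreducible P" "M2.irreducible P" for P
    using that M1.irreducible_def by (subst eval.simps) simp
  with one mul1 mul2 show ?thesis by blast
qed

text \<open>This is the uniqueness half of freeness, stated as an induction rule: two maps that respect both
multiplications and agree on the common irreducibles are equal.\<close>
lemma generated_by_common_irreducibles [consumes 0, case_names one irreducible mul1 mul2]:
  assumes "S one"
    and "\<And>P. M1.irreducible P \<Longrightarrow> M2.irreducible P \<Longrightarrow> S P"
    and "\<And>P Q. S P \<Longrightarrow> S Q \<Longrightarrow> S (mul1 P Q)"
    and "\<And>P Q. S P \<Longrightarrow> S Q \<Longrightarrow> S (mul2 P Q)"
  shows "S P"
proof (induction "weight P" arbitrary: P rule: less_induct)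
  case less
  show ?case
  proof (cases "P = one")
    case False
    show ?thesis
    proof (cases "M1.irreducible P \<and> M2.irreducible P")
      case irr: False
      then consider "\<not> M1.irreducible P" | "\<not> M2.irreducible P" by blast
      then show ?thesis
      proof cases
        case 1
        then have "S (mul1 (M1.head P) (M1.tail P))"
          using M1.weight_head_tail False assms(3) less by blast
        then show ?thesis using M1.head_tail(2)[OF False] by simp
      next
        case 2
        then have "S (mul2 (M2.head P) (M2.tail P))"
          using M2.weight_head_tail False assms(4) less by blast
        then show ?thesis using M2.head_tail(2)[OF False] by simp
      qed
    qed (use assms(2) in blast)
  qed (use assms(1) in simp)
qed

end

section \<open>Cuts of a plane poset\<close>

definition subposet :: "'a dposet \<Rightarrow> 'a set \<Rightarrow> 'a dposet" where
  "subposet X I = \<lparr>points = I, le1 = le1 X \<inter> I \<times> I, le2 = le2 X \<inter> I \<times> I\<rparr>"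

lemma subposet_simps [simp]:
  "points (subposet X I) = I"
  "le1 (subposet X I) = le1 X \<inter> I \<times> I"
  "le2 (subposet X I) = le2 X \<inter> I \<times> I"
  by (simp_all add: subposet_def)

lemma subposet_points: "double_poset X \<Longrightarrow> subposet X (points X) = X"
  by (cases X) (auto simp: subposet_def double_poset_def partial_order_on_def preorder_on_def)

lemma subposet_subposet: "J \<subseteq> I \<Longrightarrow> subposet (subposet X I) J = subposet X J"
  by (auto simp: subposet_def)

lemma partial_order_on_Int_square:
  assumes "partial_order_on A R" "I \<subseteq> A"
  shows "partial_order_on I (R \<inter> I \<times> I)"
  using assms unfolding partial_order_on_def preorder_on_def
  by (auto simp: refl_on_def antisym_def intro!: transI dest: transD)

lemma plane_poset_subposet:
  assumes "plane_poset X" "I \<subseteq> points X"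
  shows "plane_poset (subposet X I)"
  using assms partial_order_on_Int_square finite_subset
  by (auto simp: plane_poset_def double_poset_def comparable_def subset_iff)

text \<open>How a point of the first factor and a point of the second factor are related in \<open>compos1\<close> and in
\<open>compos2\<close>, respectively.\<close>
definition before1 :: "'a dposet \<Rightarrow> 'a \<Rightarrow> 'a \<Rightarrow> bool" where
  "before1 X x y \<longleftrightarrow> (x, y) \<in> le2 X \<and> \<not> comparable (le1 X) x y"

definition before2 :: "'a dposet \<Rightarrow> 'a \<Rightarrow> 'a \<Rightarrow> bool" where
  "before2 X x y \<longleftrightarrow> (x, y) \<in> le1 X \<and> \<not> comparable (le2 X) x y"

text \<open>A point that lies before itself would be incomparable to itself in the other order, against reflexivity;
so the antisymmetry of one order gives asymmetry only together with the reflexivity of the other.\<close>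
lemma before12_asym:
  assumes "double_poset X"
  shows "before1 X x y \<Longrightarrow> \<not> before1 X y x" and "before2 X x y \<Longrightarrow> \<not> before2 X y x"
proof -
  have *: "(x, x) \<in> S" if "partial_order_on A R" "partial_order_on A S" "(x, y) \<in> R" for A R S
    using that by (auto simp: partial_order_on_def preorder_on_def refl_on_def)
  have "antisym (le1 X)" "antisym (le2 X)"
    using assms by (auto simp: double_poset_def partial_order_on_def)
  then have eq: "(x, y) \<in> le1 X \<Longrightarrow> (y, x) \<in> le1 X \<Longrightarrow> x = y"
    "(x, y) \<in> le2 X \<Longrightarrow> (y, x) \<in> le2 X \<Longrightarrow> x = y"
    by (simp_all add: antisymD)
  have po: "partial_order_on (points X) (le1 X)" "partial_order_on (points X) (le2 X)"
    using assms by (auto simp: double_poset_def)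
  show "before1 X x y \<Longrightarrow> \<not> before1 X y x"
    using eq(2) *[OF po(2,1)] by (metis before1_def comparable_def)
  show "before2 X x y \<Longrightarrow> \<not> before2 X y x"
    using eq(1) *[OF po(1,2)] by (metis before2_def comparable_def)
qed

definition poset_cut :: "('a dposet \<Rightarrow> 'a \<Rightarrow> 'a \<Rightarrow> bool) \<Rightarrow> 'a dposet \<Rightarrow> 'a set \<Rightarrow> bool" where
  "poset_cut before X I \<longleftrightarrow> I \<subseteq> points X \<and> (\<forall>x\<in>I. \<forall>y\<in>points X - I. before X x y)"

text \<open>A cut exhibits \<open>X\<close> as the product of its two sides: the points on the two sides are related as the
product demands, and by antisymmetry nothing goes back from the upper side to the lower one.\<close>
lemma dposet_iso_compos_cut:
  assumes D: "double_poset X"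
  shows "poset_cut before1 X I \<Longrightarrow>
      dposet_iso (case_sum id id) (compos1 (subposet X I) (subposet X (points X - I))) X"
    and "poset_cut before2 X I \<Longrightarrow>
      dposet_iso (case_sum id id) (compos2 (subposet X I) (subposet X (points X - I))) X"
proof -
  have bij: "bij_betw (case_sum id id) (I <+> (points X - I)) (points X)" if "I \<subseteq> points X"
    using that unfolding bij_betw_def by (auto simp: inj_on_def Plus_def image_Un image_image)
  have po: "antisym (le1 X)" "antisym (le2 X)"
    using D by (auto simp: double_poset_def partial_order_on_def)
  note d = dposet_iso_def compos1_def compos2_def poset_cut_def before1_def before2_def
    rel_disjoint_sum_def rel_ordinal_sum_def comparable_def
  show "dposet_iso (case_sum id id) (compos1 (subposet X I) (subposet X (points X - I))) X"
    if "poset_cut before1 X I"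
    using that bij po by (auto simp: d dest: antisymD)
  show "dposet_iso (case_sum id id) (compos2 (subposet X I) (subposet X (points X - I))) X"
    if "poset_cut before2 X I"
    using that bij po by (auto simp: d dest: antisymD)
qed

text \<open>Conversely every factorisation comes from a cut, namely from the image of the left factor.\<close>
lemma cut_of_compos_iso:
  fixes A :: "'a dposet" and B :: "'b dposet" and f :: "'a + 'b \<Rightarrow> 'c"
  defines "I \<equiv> f ` Inl ` points A"
  shows "dposet_iso f (compos1 A B) X \<Longrightarrow> poset_cut before1 X I
      \<and> dposet_iso (f \<circ> Inl) A (subposet X I) \<and> dposet_iso (f \<circ> Inr) B (subposet X (points X - I))"
    and "dposet_iso f (compos2 A B) X \<Longrightarrow> poset_cut before2 X I
      \<and> dposet_iso (f \<circ> Inl) A (subposet X I) \<and> dposet_iso (f \<circ> Inr) B (subposet X (points X - I))"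
proof -
  have *: "bij_betw (f \<circ> Inl) (points A) I \<and> bij_betw (f \<circ> Inr) (points B) (f ` Inr ` points B)
      \<and> I \<subseteq> points X \<and> points X - I = f ` Inr ` points B"
    if "bij_betw f (points A <+> points B) (points X)"
  proof -
    have inj: "inj_on f (points A <+> points B)" and im: "f ` (points A <+> points B) = points X"
      using that by (auto simp: bij_betw_def)
    have "I \<inter> f ` Inr ` points B = {}"
      unfolding I_def using inj by (force simp: inj_on_def)
    moreover have un: "points X = I \<union> f ` Inr ` points B"
      unfolding I_def using im by (simp add: Plus_def image_Un)
    ultimately have "points X - I = f ` Inr ` points B"
      by (simp add: Un_Diff Diff_triv inf_commute)
    moreover have "I \<subseteq> points X" using un by simp
    moreover have "inj_on (f \<circ> Inl) (points A)" "inj_on (f \<circ> Inr) (points B)"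
      using inj by (auto simp: inj_on_def)
    ultimately show ?thesis
      unfolding bij_betw_def by (simp add: I_def image_comp)
  qed
  show "poset_cut before1 X I
      \<and> dposet_iso (f \<circ> Inl) A (subposet X I) \<and> dposet_iso (f \<circ> Inr) B (subposet X (points X - I))"
    if iso: "dposet_iso f (compos1 A B) X"
  proof -
    have "bij_betw f (points A <+> points B) (points X)"
      using iso by (simp add: dposet_iso_def compos1_def)
    note b = *[OF this]
    have r:
      "u \<in> points A <+> points B \<Longrightarrow> v \<in> points A <+> points B \<Longrightarrow>
        (f u, f v) \<in> le1 X \<longleftrightarrow> (u, v) \<in> rel_disjoint_sum (le1 A) (le1 B)"
      "u \<in> points A <+> points B \<Longrightarrow> v \<in> points A <+> points B \<Longrightarrow>
        (f u, f v) \<in> le2 X \<longleftrightarrow> (u, v) \<in> rel_ordinal_sum (points A) (points B) (le2 A) (le2 B)"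
      for u v
      using iso unfolding dposet_iso_def compos1_def by simp_all
    have "before1 X (f (Inl x)) (f (Inr y))" if "x \<in> points A" "y \<in> points B" for x y
      using that by (simp add: before1_def comparable_def r InlI InrI)
        (simp add: rel_disjoint_sum_def rel_ordinal_sum_def)
    then have "poset_cut before1 X I"
      using b unfolding poset_cut_def by (simp add: I_def)
    moreover have "dposet_iso (f \<circ> Inl) A (subposet X I)"
      using b by (simp add: dposet_iso_def r InlI)
        (simp add: I_def rel_disjoint_sum_def rel_ordinal_sum_def)
    moreover have "dposet_iso (f \<circ> Inr) B (subposet X (points X - I))"
      using b by (simp add: dposet_iso_def r InrI)
        (simp add: I_def rel_disjoint_sum_def rel_ordinal_sum_def)
    ultimately show ?thesis by blast
  qed
  show "poset_cut before2 X I
      \<and> dposet_iso (f \<circ> Inl) A (subposet X I) \<and> dposet_iso (f \<circ> Inr) B (subposet X (points X - I))"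
    if iso: "dposet_iso f (compos2 A B) X"
  proof -
    have "bij_betw f (points A <+> points B) (points X)"
      using iso by (simp add: dposet_iso_def compos2_def)
    note b = *[OF this]
    have r:
      "u \<in> points A <+> points B \<Longrightarrow> v \<in> points A <+> points B \<Longrightarrow>
        (f u, f v) \<in> le1 X \<longleftrightarrow> (u, v) \<in> rel_ordinal_sum (points A) (points B) (le1 A) (le1 B)"
      "u \<in> points A <+> points B \<Longrightarrow> v \<in> points A <+> points B \<Longrightarrow>
        (f u, f v) \<in> le2 X \<longleftrightarrow> (u, v) \<in> rel_disjoint_sum (le2 A) (le2 B)"
      for u v
      using iso unfolding dposet_iso_def compos2_def by simp_all
    have "before2 X (f (Inl x)) (f (Inr y))" if "x \<in> points A" "y \<in> points B" for x y
      using that by (simp add: before2_def comparable_def r InlI InrI)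
        (simp add: rel_disjoint_sum_def rel_ordinal_sum_def)
    then have "poset_cut before2 X I"
      using b unfolding poset_cut_def by (simp add: I_def)
    moreover have "dposet_iso (f \<circ> Inl) A (subposet X I)"
      using b by (simp add: dposet_iso_def r InlI)
        (simp add: I_def rel_disjoint_sum_def rel_ordinal_sum_def)
    moreover have "dposet_iso (f \<circ> Inr) B (subposet X (points X - I))"
      using b by (simp add: dposet_iso_def r InrI)
        (simp add: I_def rel_disjoint_sum_def rel_ordinal_sum_def)
    ultimately show ?thesis by blast
  qed
qed

definition pp_class :: "nat dposet \<Rightarrow> plane_pos" where
  "pp_class X = Abs_plane_pos (abs_dposet_class X)"

lemma dposet_equiv_refl: "double_poset X \<Longrightarrow> dposet_equiv X X"
  using dposet_iso_id by (auto simp: dposet_equiv_def)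

lemma class_of_plane_pp_class:
  assumes "plane_poset X"
  shows "class_of_plane (pp_class X) = abs_dposet_class X"
proof -
  have "dposet_equiv X X" using assms dposet_equiv_refl by (simp add: plane_poset_def)
  then have "plane_class (abs_dposet_class X)" using assms by (simp add: plane_class.abs_eq)
  then show ?thesis by (simp add: pp_class_def Abs_plane_pos_inverse)
qed

lemma pp_class_eq_iff:
  assumes "plane_poset X" "plane_poset Y"
  shows "pp_class X = pp_class Y \<longleftrightarrow> (\<exists>f. dposet_iso f X Y)"
proof -
  have "pp_class X = pp_class Y \<longleftrightarrow> abs_dposet_class X = abs_dposet_class Y"
    using assms class_of_plane_pp_class by (metis pp_class_def)
  also have "\<dots> \<longleftrightarrow> dposet_equiv X Y"
    using assms Quotient3_rel[OF Quotient3_dposet_class, of X Y] dposet_equiv_refl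
    by (simp add: plane_poset_def)
  finally show ?thesis using assms by (simp add: dposet_equiv_def plane_poset_def)
qed

text \<open>Every class has a representative, so that statements about classes reduce to statements about cuts of
one concrete poset.\<close>
lemma plane_pos_cases:
  obtains X where "plane_poset X" "P = pp_class X"
proof -
  obtain X where X: "dposet_equiv X X" "class_of_plane P = abs_dposet_class X"
    using Quotient3_rep_reflp[OF Quotient3_dposet_class] Quotient3_abs_rep[OF Quotient3_dposet_class]
    by metis
  moreover have "plane_class (class_of_plane P)" using class_of_plane by simp
  ultimately have "plane_poset X" by (simp add: plane_class.abs_eq)
  moreover have "P = pp_class X"
    using X(2) by (metis class_of_plane_inverse pp_class_def)
  ultimately show ?thesis by (rule that)
qed

lemma pp_compos_pp_class:
  assumes "plane_poset X" "plane_poset Y"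
  shows "pp_compos1 (pp_class X) (pp_class Y) = pp_class (dposet_rename sum_encode (compos1 X Y))"
    and "pp_compos2 (pp_class X) (pp_class Y) = pp_class (dposet_rename sum_encode (compos2 X Y))"
proof -
  have "dposet_equiv X X" "dposet_equiv Y Y"
    using assms dposet_equiv_refl by (simp_all add: plane_poset_def)
  then show "pp_compos1 (pp_class X) (pp_class Y) = pp_class (dposet_rename sum_encode (compos1 X Y))"
    "pp_compos2 (pp_class X) (pp_class Y) = pp_class (dposet_rename sum_encode (compos2 X Y))"
    using assms
    by (simp_all add: pp_compos1_def pp_compos2_def class_of_plane_pp_class compos1_class.abs_eq
        compos2_class.abs_eq pp_class_def[symmetric])
qed

lemma pp_compos_eq_pp_class_iff:
  assumes "plane_poset A" "plane_poset B" "plane_poset X"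
  shows "pp_compos1 (pp_class A) (pp_class B) = pp_class X \<longleftrightarrow> (\<exists>f. dposet_iso f (compos1 A B) X)"
    and "pp_compos2 (pp_class A) (pp_class B) = pp_class X \<longleftrightarrow> (\<exists>f. dposet_iso f (compos2 A B) X)"
proof -
  have *: "(\<exists>f. dposet_iso f (dposet_rename sum_encode Z) X) \<longleftrightarrow> (\<exists>f. dposet_iso f Z X)"
    for Z :: "(nat + nat) dposet"
    using dposet_iso_trans dposet_iso_sym dposet_iso_rename[OF inj_sum_encode] by metis
  show "pp_compos1 (pp_class A) (pp_class B) = pp_class X \<longleftrightarrow> (\<exists>f. dposet_iso f (compos1 A B) X)"
    "pp_compos2 (pp_class A) (pp_class B) = pp_class X \<longleftrightarrow> (\<exists>f. dposet_iso f (compos2 A B) X)"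
    using assms by (simp_all add: pp_compos_pp_class pp_class_eq_iff plane_poset_rename
        inj_sum_encode plane_poset_compos *)
qed

text \<open>From here on the products are handled through cuts only: a factorisation of a class is the same as a cut
of any fixed representative. Different factorisations of one class thereby become subsets of a
single poset, where they can be compared.\<close>
lemma pp_compos_iff_cut:
  assumes X: "plane_poset X"
  shows "pp_compos1 P Q = pp_class X \<longleftrightarrow> (\<exists>I. poset_cut before1 X I
      \<and> P = pp_class (subposet X I) \<and> Q = pp_class (subposet X (points X - I)))"
    and "pp_compos2 P Q = pp_class X \<longleftrightarrow> (\<exists>I. poset_cut before2 X I
      \<and> P = pp_class (subposet X I) \<and> Q = pp_class (subposet X (points X - I)))"
proof -
  obtain A where A: "plane_poset A" "P = pp_class A" by (rule plane_pos_cases)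
  obtain B where B: "plane_poset B" "Q = pp_class B" by (rule plane_pos_cases)
  have D: "double_poset X" using X by (simp add: plane_poset_def)
  have sub: "plane_poset (subposet X I)" "plane_poset (subposet X (points X - I))"
    if "poset_cut before X I" for before I
    using that plane_poset_subposet[OF X] by (auto simp: poset_cut_def)
  show "pp_compos1 P Q = pp_class X \<longleftrightarrow> (\<exists>I. poset_cut before1 X I
      \<and> P = pp_class (subposet X I) \<and> Q = pp_class (subposet X (points X - I)))"
  proof
    assume "pp_compos1 P Q = pp_class X"
    then obtain f where "dposet_iso f (compos1 A B) X"
      using pp_compos_eq_pp_class_iff(1)[OF A(1) B(1) X] A(2) B(2) by blast
    from cut_of_compos_iso(1)[OF this] show "\<exists>I. poset_cut before1 X I
      \<and> P = pp_class (subposet X I) \<and> Q = pp_class (subposet X (points X - I))"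
      using A B sub pp_class_eq_iff by blast
  next
    assume "\<exists>I. poset_cut before1 X I
      \<and> P = pp_class (subposet X I) \<and> Q = pp_class (subposet X (points X - I))"
    then show "pp_compos1 P Q = pp_class X"
      using dposet_iso_compos_cut(1)[OF D] pp_compos_eq_pp_class_iff(1) sub X by blast
  qed
  show "pp_compos2 P Q = pp_class X \<longleftrightarrow> (\<exists>I. poset_cut before2 X I
      \<and> P = pp_class (subposet X I) \<and> Q = pp_class (subposet X (points X - I)))"
  proof
    assume "pp_compos2 P Q = pp_class X"
    then obtain f where "dposet_iso f (compos2 A B) X"
      using pp_compos_eq_pp_class_iff(2)[OF A(1) B(1) X] A(2) B(2) by blast
    from cut_of_compos_iso(2)[OF this] show "\<exists>I. poset_cut before2 X I
      \<and> P = pp_class (subposet X I) \<and> Q = pp_class (subposet X (points X - I))"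
      using A B sub pp_class_eq_iff by blast
  next
    assume "\<exists>I. poset_cut before2 X I
      \<and> P = pp_class (subposet X I) \<and> Q = pp_class (subposet X (points X - I))"
    then show "pp_compos2 P Q = pp_class X"
      using dposet_iso_compos_cut(2)[OF D] pp_compos_eq_pp_class_iff(2) sub X by blast
  qed
qed

lift_definition dposet_class_size :: "dposet_class \<Rightarrow> nat" is "\<lambda>X. card (points X)"
  by (auto simp: dposet_equiv_def dposet_iso_def dest: bij_betw_same_card)

definition pp_size :: "plane_pos \<Rightarrow> nat" where
  "pp_size P = dposet_class_size (class_of_plane P)"

lemma pp_size_pp_class: "plane_poset X \<Longrightarrow> pp_size (pp_class X) = card (points X)"
  by (simp add: pp_size_def class_of_plane_pp_class dposet_class_size.abs_eq dposet_equiv_refl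
      plane_poset_def)

lemma plane_poset_empty: "plane_poset empty_dposet"
  by (simp add: plane_poset_def double_poset_empty) (simp add: empty_dposet_def)

lemma pp_one_eq: "pp_one = pp_class empty_dposet"
  by (simp add: pp_one_def pp_class_def empty_class_def)

lemma pp_class_eq_one_iff:
  assumes "plane_poset X"
  shows "pp_class X = pp_one \<longleftrightarrow> points X = {}"
  unfolding pp_one_eq pp_class_eq_iff[OF assms plane_poset_empty]
  by (auto simp: dposet_iso_def empty_dposet_def bij_betw_def)

text \<open>What both products have in common. Restriction to subposets makes cuts of cuts into cuts, which
gives the monoid laws; asymmetry makes the cuts of a poset a chain, which gives Levi's condition.\<close>
locale cut_product =
  fixes mul :: "plane_pos \<Rightarrow> plane_pos \<Rightarrow> plane_pos" (infixl "\<cdot>" 70)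
    and before :: "nat dposet \<Rightarrow> nat \<Rightarrow> nat \<Rightarrow> bool"
  assumes before_subposet: "x \<in> I \<Longrightarrow> y \<in> I \<Longrightarrow> before (subposet X I) x y \<longleftrightarrow> before X x y"
    and before_asym: "double_poset X \<Longrightarrow> before X x y \<Longrightarrow> \<not> before X y x"
    and mul_eq_pp_class_iff: "plane_poset X \<Longrightarrow> P \<cdot> Q = pp_class X \<longleftrightarrow>
      (\<exists>I. poset_cut before X I \<and> P = pp_class (subposet X I) \<and> Q = pp_class (subposet X (points X - I)))"
begin

abbreviation is_cut :: "nat dposet \<Rightarrow> nat set \<Rightarrow> bool" where
  "is_cut \<equiv> poset_cut before"

lemma mul_eq_pp_classE:
  assumes "plane_poset X" "P \<cdot> Q = pp_class X"
  obtains I where "is_cut X I" "P = pp_class (subposet X I)" "Q = pp_class (subposet X (points X - I))"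
  using assms mul_eq_pp_class_iff by blast

lemma is_cut_subset: "is_cut X I \<Longrightarrow> I \<subseteq> points X"
  by (simp add: poset_cut_def)

lemma is_cut_trivial: "is_cut X {}" "is_cut X (points X)"
  by (simp_all add: poset_cut_def)

lemma is_cut_trans: "is_cut X I \<Longrightarrow> is_cut (subposet X I) J \<Longrightarrow> is_cut X J"
  unfolding poset_cut_def using before_subposet by (metis DiffE DiffI subset_iff subposet_simps(1))

lemma is_cut_Int:
  assumes "is_cut X J" "I \<subseteq> points X"
  shows "is_cut (subposet X I) (J \<inter> I)"
proof -
  have "before X x y" if "x \<in> J \<inter> I" "y \<in> I - J \<inter> I" for x y
    using that assms unfolding poset_cut_def by blast
  then show ?thesis
    by (auto simp: poset_cut_def before_subposet)
qed

lemma mul_is_cut: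
  "plane_poset X \<Longrightarrow> is_cut X I \<Longrightarrow> pp_class (subposet X I) \<cdot> pp_class (subposet X (points X - I)) = pp_class X"
  using mul_eq_pp_class_iff by blast

text \<open>Two nested cuts \<open>J \<subseteq> I\<close> slice the poset into the three layers \<open>J\<close>, \<open>I - J\<close> and \<open>points X - I\<close>, and
products of adjacent layers are again sides of a cut. This gives associativity, and with \<open>is_cut_chain\<close> the
middle layer is the common refinement of two factorisations.\<close>
lemma mul_nested_cuts:
  assumes X: "plane_poset X" and I: "is_cut X I" and J: "is_cut X J" and le: "J \<subseteq> I"
  shows "pp_class (subposet X J) \<cdot> pp_class (subposet X (I - J)) = pp_class (subposet X I)"
    and "pp_class (subposet X (I - J)) \<cdot> pp_class (subposet X (points X - I)) = pp_class (subposet X (points X - J))"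
proof -
  note s = is_cut_subset[OF I]
  have "J \<inter> I = J" "I \<inter> (points X - J) = I - J" "points X - J - (I - J) = points X - I"
    using s le by auto
  then have "is_cut (subposet X I) J" "is_cut (subposet X (points X - J)) (I - J)"
    using is_cut_Int[OF J s] is_cut_Int[OF I, of "points X - J"] by auto
  from mul_is_cut[OF plane_poset_subposet[OF X s] this(1)]
    mul_is_cut[OF plane_poset_subposet[OF X] this(2)]
  show "pp_class (subposet X J) \<cdot> pp_class (subposet X (I - J)) = pp_class (subposet X I)"
    "pp_class (subposet X (I - J)) \<cdot> pp_class (subposet X (points X - I)) = pp_class (subposet X (points X - J))"
    using le by (simp_all add: subposet_subposet \<open>points X - J - (I - J) = points X - I\<close> Diff_mono
        Diff_subset[of I J] s)
qed

lemma is_cut_chain: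
  assumes X: "double_poset X" and I: "is_cut X I" and J: "is_cut X J"
  shows "I \<subseteq> J \<or> J \<subseteq> I"
proof (rule ccontr)
  assume "\<not> (I \<subseteq> J \<or> J \<subseteq> I)"
  then obtain x y where "x \<in> I - J" "y \<in> J - I" by blast
  with I J have "before X x y" "before X y x" by (auto simp: poset_cut_def)
  with before_asym[OF X] show False by blast
qed

sublocale equidivisible_monoid mul pp_one pp_size
proof
  show "(P \<cdot> Q) \<cdot> R = P \<cdot> (Q \<cdot> R)" for P Q R
  proof -
    obtain X where X: "plane_poset X" "(P \<cdot> Q) \<cdot> R = pp_class X" by (rule plane_pos_cases)
    from mul_eq_pp_classE[OF this] obtain I where I: "is_cut X I" "P \<cdot> Q = pp_class (subposet X I)"
      "R = pp_class (subposet X (points X - I))" .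
    note XI = plane_poset_subposet[OF X(1) is_cut_subset[OF I(1)]]
    from mul_eq_pp_classE[OF XI I(2)] obtain J where J: "is_cut (subposet X I) J"
      "P = pp_class (subposet (subposet X I) J)"
      "Q = pp_class (subposet (subposet X I) (points (subposet X I) - J))" .
    have JI: "J \<subseteq> I" using is_cut_subset[OF J(1)] by simp
    note XJ = is_cut_trans[OF I(1) J(1)]
    have "P = pp_class (subposet X J)" "Q = pp_class (subposet X (I - J))"
      using J(2,3) JI by (simp_all add: subposet_subposet)
    then have "P \<cdot> (Q \<cdot> R) = pp_class X"
      using mul_nested_cuts(2)[OF X(1) I(1) XJ JI] mul_is_cut[OF X(1) XJ] I(3) by simp
    then show ?thesis using X(2) by simp
  qed
  show "pp_one \<cdot> P = P" "P \<cdot> pp_one = P" for P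
  proof -
    obtain X where X: "plane_poset X" "P = pp_class X" by (rule plane_pos_cases)
    have "pp_class (subposet X {}) = pp_one"
      using plane_poset_subposet[OF X(1), of "{}"] by (simp add: pp_class_eq_one_iff)
    moreover have "subposet X (points X) = X"
      using X(1) by (simp add: subposet_points plane_poset_def)
    ultimately show "pp_one \<cdot> P = P" "P \<cdot> pp_one = P"
      using mul_is_cut[OF X(1) is_cut_trivial(1)] mul_is_cut[OF X(1) is_cut_trivial(2)] X(2)
      by simp_all
  qed
  show "pp_size (P \<cdot> Q) = pp_size P + pp_size Q" for P Q
  proof -
    obtain X where X: "plane_poset X" "P \<cdot> Q = pp_class X" by (rule plane_pos_cases)
    from mul_eq_pp_classE[OF this] obtain I where I: "is_cut X I" "P = pp_class (subposet X I)"
      "Q = pp_class (subposet X (points X - I))" .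
    have "finite (points X)" using X(1) by (simp add: plane_poset_def double_poset_def)
    then have "card (points X) = card I + card (points X - I)"
      using is_cut_subset[OF I(1)] by (metis card_Diff_subset card_mono finite_subset le_add_diff_inverse)
    then show ?thesis
      using X I is_cut_subset[OF I(1)] by (simp add: pp_size_pp_class plane_poset_subposet)
  qed
  show "pp_size P = 0 \<longleftrightarrow> P = pp_one" for P
  proof -
    obtain X where X: "plane_poset X" "P = pp_class X" by (rule plane_pos_cases)
    then have "finite (points X)" by (simp add: plane_poset_def double_poset_def)
    then show ?thesis using X by (simp add: pp_size_pp_class pp_class_eq_one_iff)
  qed
  show "\<exists>E. C = A \<cdot> E \<and> B = E \<cdot> D" if eq: "A \<cdot> B = C \<cdot> D" and le: "pp_size A \<le> pp_size C"
    for A B C D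
  proof -
    obtain X where X: "plane_poset X" "A \<cdot> B = pp_class X" by (rule plane_pos_cases)
    from mul_eq_pp_classE[OF this] obtain I where I: "is_cut X I" "A = pp_class (subposet X I)"
      "B = pp_class (subposet X (points X - I))" .
    from mul_eq_pp_classE[OF X(1)] eq X(2) obtain J where J: "is_cut X J" "C = pp_class (subposet X J)"
      "D = pp_class (subposet X (points X - J))" by metis
    \<comment> \<open>The cuts form a chain, so the cardinalities decide which of \<open>I\<close> and \<open>J\<close> contains the other.\<close>
    have D: "double_poset X" and finI: "finite I"
      using X(1) is_cut_subset[OF I(1)]
      by (auto simp: plane_poset_def double_poset_def intro: finite_subset)
    have "card I \<le> card J"
      using le I J X(1) by (simp add: pp_size_pp_class plane_poset_subposet is_cut_subset)
    then have "I \<subseteq> J"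
      using is_cut_chain[OF D I(1) J(1)] finI card_seteq[OF finI, of J] by blast
    then show ?thesis using mul_nested_cuts[OF X(1) J(1) I(1)] I J by metis
  qed
qed

lemma irreducible_pp_class_iff:
  assumes X: "plane_poset X"
  shows "irreducible (pp_class X) \<longleftrightarrow>
    points X \<noteq> {} \<and> (\<forall>I. is_cut X I \<longrightarrow> I = {} \<or> I = points X)"
proof -
  have "(\<forall>A B. pp_class X = A \<cdot> B \<longrightarrow> A = pp_one \<or> B = pp_one) \<longleftrightarrow>
    (\<forall>I. is_cut X I \<longrightarrow> pp_class (subposet X I) = pp_one \<or> pp_class (subposet X (points X - I)) = pp_one)"
    using mul_eq_pp_class_iff[OF X] by metis
  also have "\<dots> \<longleftrightarrow> (\<forall>I. is_cut X I \<longrightarrow> I = {} \<or> I = points X)"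
    using is_cut_subset X by (auto simp: pp_class_eq_one_iff plane_poset_subposet)
  finally show ?thesis by (simp add: irreducible_def pp_class_eq_one_iff[OF X])
qed

end

interpretation PP1: cut_product pp_compos1 before1
proof
  show "before1 (subposet X I) x y \<longleftrightarrow> before1 X x y" if "x \<in> I" "y \<in> I" for x y I and X :: "nat dposet"
    using that by (auto simp: before1_def comparable_def)
  show "\<not> before1 X y x" if "double_poset X" "before1 X x y" for X :: "nat dposet" and x y
    using that by (rule before12_asym(1))
qed (rule pp_compos_iff_cut(1))

interpretation PP2: cut_product pp_compos2 before2
proof
  show "before2 (subposet X I) x y \<longleftrightarrow> before2 X x y" if "x \<in> I" "y \<in> I" for x y I and X :: "nat dposet"
    using that by (auto simp: before2_def comparable_def)
  show "\<not> before2 X y x" if "double_poset X" "before2 X x y" for X :: "nat dposet" and x y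
    using that by (rule before12_asym(2))
qed (rule pp_compos_iff_cut(2))

interpretation PP: two_equidivisible_monoids pp_compos1 pp_compos2 pp_one pp_size
proof
  show "A = pp_one \<or> B = pp_one \<or> C = pp_one \<or> D = pp_one"
    if eq: "pp_compos1 A B = pp_compos2 C D" for A B C D
  proof (rule ccontr)
    assume non_one: "\<not> ?thesis"
    obtain X where X: "plane_poset X" "pp_compos1 A B = pp_class X" by (rule plane_pos_cases)
    from PP1.mul_eq_pp_classE[OF this] obtain I where I: "PP1.is_cut X I" "A = pp_class (subposet X I)"
      "B = pp_class (subposet X (points X - I))" .
    have "pp_compos2 C D = pp_class X" using eq X(2) by simp
    from PP2.mul_eq_pp_classE[OF X(1) this] obtain J where J: "PP2.is_cut X J"
      "C = pp_class (subposet X J)" "D = pp_class (subposet X (points X - J))" .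
    have sub: "I \<subseteq> points X" "J \<subseteq> points X"
      using I(1) J(1) by (simp_all add: poset_cut_def)
    have plane: "plane_poset (subposet X K)" if "K \<subseteq> points X" for K
      using plane_poset_subposet[OF X(1) that] .
    have "I \<noteq> {}" "points X - I \<noteq> {}" and J_proper: "J \<noteq> {}" "points X - J \<noteq> {}"
      using non_one unfolding I(2,3) J(2,3)
      by (simp_all add: pp_class_eq_one_iff plane sub)
    then obtain a b where ab: "a \<in> I" "b \<in> points X - I" by blast
    \<comment> \<open>Two points related by \<open>before1\<close> are not comparable in the order that \<open>before2\<close> requires.\<close>
    have same_side: "x \<in> J \<longleftrightarrow> y \<in> J" if "x \<in> I" "y \<in> points X - I" for x y
    proof (rule ccontr)
      assume "\<not> ?thesis"
      then have "before2 X x y \<or> before2 X y x"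
        using that sub J(1) by (auto simp: poset_cut_def)
      moreover have "before1 X x y" using that I(1) by (simp add: poset_cut_def)
      ultimately show False by (auto simp: before1_def before2_def comparable_def)
    qed
    \<comment> \<open>Passing through the opposite side of the cut \<open>I\<close> connects any two points, so \<open>J\<close> is trivial.\<close>
    have "x \<in> J \<longleftrightarrow> a \<in> J" if "x \<in> points X" for x
      using same_side[of x b] same_side[of a b] same_side[of a x] ab that by blast
    then show False using J_proper sub(2) by blast
  qed
qed

text \<open>Indecomposability speaks of cuts of a representative, irreducibility of factorisations of the class; the
empty poset has only trivial cuts but is the unit, so it has to be excluded on the left.\<close>
lemma indecomposable12_iff:
  "P \<noteq> pp_one \<and> indecomposable12 P \<longleftrightarrow> PP1.irreducible P \<and> PP2.irreducible P"
proof -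
  obtain X where X: "plane_poset X" "P = pp_class X" by (rule plane_pos_cases)
  have "dposet_equiv X X" using X(1) by (simp add: dposet_equiv_refl plane_poset_def)
  then have "indecomposable12 P \<longleftrightarrow> indecomposable1 X \<and> indecomposable2 X"
    using X by (simp add: indecomposable12_def class_of_plane_pp_class indecomposable1_class.abs_eq
        indecomposable2_class.abs_eq)
  moreover have "indecomposable1 X \<longleftrightarrow> (\<forall>I. PP1.is_cut X I \<longrightarrow> I = {} \<or> I = points X)"
    by (simp add: indecomposable1_def poset_cut_def before1_def imp_conjL)
  moreover have "indecomposable2 X \<longleftrightarrow> (\<forall>I. PP2.is_cut X I \<longrightarrow> I = {} \<or> I = points X)"
    by (simp add: indecomposable2_def poset_cut_def before2_def imp_conjL)
  ultimately show ?thesis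
    unfolding X(2) PP1.irreducible_pp_class_iff[OF X(1)] PP2.irreducible_pp_class_iff[OF X(1)]
      pp_class_eq_one_iff[OF X(1)] by metis
qed

section \<open>Linearisation\<close>

lemma lookup_H_scale [simp]: "Poly_Mapping.lookup (H_scale c x) P = c * Poly_Mapping.lookup x P"
  by (simp add: H_scale_def map.rep_eq when_def)

lemma keys_H_scale_subset: "Poly_Mapping.keys (H_scale c x) \<subseteq> Poly_Mapping.keys x"
  by (auto simp: in_keys_iff)

lemma vector_space_H_scale: "vector_space (H_scale :: 'k::field \<Rightarrow> _)"
  by unfold_locales (auto intro!: poly_mapping_eqI simp: lookup_add algebra_simps)

definition lin_ext :: "('k::field \<Rightarrow> 'b::ab_group_add \<Rightarrow> 'b) \<Rightarrow> (plane_pos \<Rightarrow> 'b) \<Rightarrow> 'k H_PP \<Rightarrow> 'b" where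
  "lin_ext s g x = (\<Sum>P\<in>Poly_Mapping.keys x. s (Poly_Mapping.lookup x P) (g P))"

context vector_space
begin

lemma lin_ext_superset:
  assumes "finite K" "Poly_Mapping.keys x \<subseteq> K"
  shows "lin_ext scale g x = (\<Sum>P\<in>K. scale (Poly_Mapping.lookup x P) (g P))"
  unfolding lin_ext_def using assms
  by (intro sum.mono_neutral_left) (auto simp: in_keys_iff)

lemma lin_ext_basis: "lin_ext scale g (H_basis P) = g P"
  by (simp add: lin_ext_def H_basis_def)

lemma linear_lin_ext: "Vector_Spaces.linear H_scale scale (lin_ext scale g)"
  unfolding Vector_Spaces.linear_iff
proof (intro conjI allI)
  show "vector_space H_scale" by (rule vector_space_H_scale)
  show "vector_space scale" by (rule vector_space_axioms)
  fix x y :: "'a H_PP" and c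
  let ?K = "Poly_Mapping.keys x \<union> Poly_Mapping.keys y"
  have fin: "finite ?K" by simp
  have "lin_ext scale g z = (\<Sum>P\<in>?K. scale (Poly_Mapping.lookup z P) (g P))"
    if "z \<in> {x, y, x + y, H_scale c x}" for z
    by (rule lin_ext_superset[OF fin]) (use that keys_add keys_H_scale_subset in fastforce)
  then show "lin_ext scale g (x + y) = lin_ext scale g x + lin_ext scale g y"
    and "lin_ext scale g (H_scale c x) = scale c (lin_ext scale g x)"
    by (simp_all add: lookup_add scale_left_distrib sum.distrib scale_sum_right)
qed

end

lemma lin_ext_H_basis: "lin_ext H_scale H_basis x = x"
proof (rule poly_mapping_eqI)
  fix P
  have "Poly_Mapping.lookup (lin_ext H_scale H_basis x) P
      = (\<Sum>Q\<in>Poly_Mapping.keys x. if Q = P then Poly_Mapping.lookup x Q else 0)"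
    unfolding lin_ext_def lookup_sum
    by (intro sum.cong refl) (simp add: H_basis_def lookup_single when_def)
  also have "\<dots> = Poly_Mapping.lookup x P" by (simp add: in_keys_iff)
  finally show "Poly_Mapping.lookup (lin_ext H_scale H_basis x) P = Poly_Mapping.lookup x P" .
qed

lemma linear_eq_lin_ext:
  assumes "Vector_Spaces.linear H_scale s g"
  shows "g x = lin_ext s (\<lambda>P. g (H_basis P)) x"
proof -
  interpret Vector_Spaces.linear H_scale s g by fact
  have "g x = g (lin_ext H_scale H_basis x)" by (simp add: lin_ext_H_basis)
  also have "\<dots> = lin_ext s (\<lambda>P. g (H_basis P)) x" by (simp add: lin_ext_def sum scale)
  finally show ?thesis .
qed

lemma linear_eqI:
  assumes "Vector_Spaces.linear H_scale s g" "Vector_Spaces.linear H_scale s h"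
    and "\<And>P. g (H_basis P) = h (H_basis P)"
  shows "g x = h x"
  by (subst linear_eq_lin_ext[OF assms(1), of x], subst linear_eq_lin_ext[OF assms(2), of x])
    (simp add: assms(3))

lemma bilinear_extension_eq_lin_ext:
  "bilinear_extension op x y = lin_ext H_scale (\<lambda>P. lin_ext H_scale (\<lambda>Q. H_basis (op P Q)) y) x"
proof -
  interpret vector_space "H_scale :: 'a \<Rightarrow> _" by (rule vector_space_H_scale)
  have "H_scale c (Poly_Mapping.single P d) = Poly_Mapping.single P (c * d)" for P and c d :: 'a
    by (rule poly_mapping_eqI) (simp add: lookup_single when_def)
  then show ?thesis
    by (simp add: bilinear_extension_def lin_ext_def H_basis_def scale_sum_right)
qed

lemma bilinear_extension_linear:
  fixes x y :: "'k::field H_PP"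
  shows "Vector_Spaces.linear H_scale H_scale (\<lambda>x. bilinear_extension op x y)"
    and "Vector_Spaces.linear H_scale H_scale (\<lambda>y. bilinear_extension op x y)"
proof -
  interpret vector_space "H_scale :: 'k \<Rightarrow> _" by (rule vector_space_H_scale)
  show "Vector_Spaces.linear H_scale H_scale (\<lambda>x. bilinear_extension op x y)"
    unfolding bilinear_extension_eq_lin_ext by (rule linear_lin_ext)
  have "lin_ext H_scale g (y + z) = lin_ext H_scale g y + lin_ext H_scale g z"
    "lin_ext H_scale g (H_scale c y) = H_scale c (lin_ext H_scale g y)"
    for g :: "plane_pos \<Rightarrow> 'k H_PP" and y z c
    using linear_lin_ext[of g] by (simp_all add: Vector_Spaces.linear_iff)
  then show "Vector_Spaces.linear H_scale H_scale (\<lambda>y. bilinear_extension op x y)"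
    unfolding bilinear_extension_eq_lin_ext Vector_Spaces.linear_iff
    by (simp add: vector_space_H_scale)
      (simp add: lin_ext_def[where x = x] scale_right_distrib sum.distrib scale_sum_right mult.commute)
qed

lemma bilinear_extension_basis:
  "bilinear_extension op (H_basis P) (H_basis Q) = H_basis (op P Q)"
proof -
  interpret vector_space "H_scale :: 'a \<Rightarrow> _" by (rule vector_space_H_scale)
  show ?thesis by (simp add: bilinear_extension_eq_lin_ext lin_ext_basis)
qed

text \<open>Both sides are linear in \<open>x\<close> and in \<open>y\<close>, so it is enough to compare them on basis elements, one
argument at a time. Associativity and the unit laws below are reduced to the basis in the same way.\<close>
lemma multiplicative_on_basis:
  assumes g: "Vector_Spaces.linear H_scale s g"
    and m: "\<And>b. Vector_Spaces.linear s s (\<lambda>a. m a b)" "\<And>a. Vector_Spaces.linear s s (\<lambda>b. m a b)"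
    and basis: "\<And>P Q. g (H_basis (op P Q)) = m (g (H_basis P)) (g (H_basis Q))"
  shows "g (bilinear_extension op x y) = m (g x) (g y)"
proof (rule linear_eqI[where g = "\<lambda>x. g (bilinear_extension op x y)" and h = "\<lambda>x. m (g x) (g y)"])
  show "Vector_Spaces.linear H_scale s (\<lambda>x. g (bilinear_extension op x y))"
    using Vector_Spaces.linear_compose[OF bilinear_extension_linear(1) g] by (simp add: o_def)
  show "Vector_Spaces.linear H_scale s (\<lambda>x. m (g x) (g y))"
    using Vector_Spaces.linear_compose[OF g m(1)] by (simp add: o_def)
  show "g (bilinear_extension op (H_basis P) y) = m (g (H_basis P)) (g y)" for P
  proof (rule linear_eqI[where g = "\<lambda>y. g (bilinear_extension op (H_basis P) y)"
        and h = "\<lambda>y. m (g (H_basis P)) (g y)"])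
    show "Vector_Spaces.linear H_scale s (\<lambda>y. g (bilinear_extension op (H_basis P) y))"
      using Vector_Spaces.linear_compose[OF bilinear_extension_linear(2) g] by (simp add: o_def)
    show "Vector_Spaces.linear H_scale s (\<lambda>y. m (g (H_basis P)) (g y))"
      using Vector_Spaces.linear_compose[OF g m(2)] by (simp add: o_def)
    show "g (bilinear_extension op (H_basis P) (H_basis Q)) = m (g (H_basis P)) (g (H_basis Q))" for Q
      by (simp add: bilinear_extension_basis basis)
  qed
qed

lemma bilinear_extension_assoc:
  assumes "\<And>P Q R. op (op P Q) R = op P (op Q R)"
  shows "bilinear_extension op (bilinear_extension op x y) z
    = bilinear_extension op x (bilinear_extension op y z)"
proof -
  let ?m = "bilinear_extension op"
  note lin = bilinear_extension_linear[of op]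
  have basis: "?m (?m (H_basis P) (H_basis Q)) z = ?m (H_basis P) (?m (H_basis Q) z)" for P Q
  proof (rule linear_eqI[where g = "\<lambda>z. ?m (?m (H_basis P) (H_basis Q)) z"
        and h = "\<lambda>z. ?m (H_basis P) (?m (H_basis Q) z)"])
    show "Vector_Spaces.linear H_scale H_scale (\<lambda>z. ?m (H_basis P) (?m (H_basis Q) z))"
      using Vector_Spaces.linear_compose[OF lin(2) lin(2)] by (simp add: o_def)
  qed (simp_all add: lin bilinear_extension_basis assms)
  have left: "?m (?m (H_basis P) y) z = ?m (H_basis P) (?m y z)" for P
  proof (rule linear_eqI[where g = "\<lambda>y. ?m (?m (H_basis P) y) z"
        and h = "\<lambda>y. ?m (H_basis P) (?m y z)"])
    show "Vector_Spaces.linear H_scale H_scale (\<lambda>y. ?m (?m (H_basis P) y) z)"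
      using Vector_Spaces.linear_compose[OF lin(2) lin(1)] by (simp add: o_def)
    show "Vector_Spaces.linear H_scale H_scale (\<lambda>y. ?m (H_basis P) (?m y z))"
      using Vector_Spaces.linear_compose[OF lin(1) lin(2)] by (simp add: o_def)
  qed (rule basis)
  show ?thesis
  proof (rule linear_eqI[where g = "\<lambda>x. ?m (?m x y) z" and h = "\<lambda>x. ?m x (?m y z)"])
    show "Vector_Spaces.linear H_scale H_scale (\<lambda>x. ?m (?m x y) z)"
      using Vector_Spaces.linear_compose[OF lin(1) lin(1)] by (simp add: o_def)
  qed (rule lin left)+
qed

lemma bilinear_extension_unit:
  assumes "\<And>P. op e P = P" "\<And>P. op P e = P"
  shows "bilinear_extension op (H_basis e) x = x" "bilinear_extension op x (H_basis e) = x"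
proof -
  have id: "Vector_Spaces.linear H_scale H_scale (\<lambda>x :: 'a H_PP. x)"
    using vector_space.linear_id[OF vector_space_H_scale] by (simp add: id_def)
  show "bilinear_extension op (H_basis e) x = x"
    by (rule linear_eqI[OF bilinear_extension_linear(2) id])
      (simp add: bilinear_extension_basis assms)
  show "bilinear_extension op x (H_basis e) = x"
    by (rule linear_eqI[OF bilinear_extension_linear(1) id])
      (simp add: bilinear_extension_basis assms)
qed

lemma two_As_algebra_H_PP:
  "two_As_algebra (H_scale :: 'k::field \<Rightarrow> _) H_compos1 H_compos2 (H_basis pp_one)"
  unfolding H_compos1_def H_compos2_def
  by (intro two_As_algebra.intro two_As_algebra_axioms.intro vector_space_H_scale
      bilinear_extension_linear bilinear_extension_assoc bilinear_extension_unit
      PP1.mul_assoc PP2.mul_assoc PP1.mul_one PP2.mul_one)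

theorem theorem15:
  shows "freely_generated_two_As TYPE('b::ab_group_add)
           (H_scale :: 'k::field \<Rightarrow> 'k H_PP \<Rightarrow> 'k H_PP) H_compos1 H_compos2 (H_basis pp_one)
           (H_basis ` {P. P \<noteq> pp_one \<and> indecomposable12 P})"
  unfolding freely_generated_two_As_def indecomposable12_iff
proof (intro conjI allI impI)
  show "two_As_algebra (H_scale :: 'k \<Rightarrow> _) H_compos1 H_compos2 (H_basis pp_one)"
    by (rule two_As_algebra_H_PP)
  fix sB :: "'k \<Rightarrow> 'b \<Rightarrow> 'b" and m1 m2 u and f :: "'k H_PP \<Rightarrow> 'b"
  assume "two_As_algebra sB m1 m2 u"
  then interpret B: two_As_algebra sB m1 m2 u .
  let ?S = "H_basis ` {P. PP1.irreducible P \<and> PP2.irreducible P} :: 'k H_PP set"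
  let ?hom = "two_As_morphism H_scale H_compos1 H_compos2 (H_basis pp_one) sB m1 m2 u"
  obtain g where g: "g pp_one = u" "\<And>P Q. g (pp_compos1 P Q) = m1 (g P) (g Q)"
    "\<And>P Q. g (pp_compos2 P Q) = m2 (g P) (g Q)"
    "\<And>P. PP1.irreducible P \<Longrightarrow> PP2.irreducible P \<Longrightarrow> g P = f (H_basis P)"
    using PP.free_on_common_irreducibles[of m1 u m2 "\<lambda>P. f (H_basis P)",
        OF B.m1_assoc B.m1_unit B.m2_assoc B.m2_unit] by blast
  show "\<exists>!\<phi>. ?hom \<phi> \<and> (\<forall>x\<in>?S. \<phi> x = f x)"
  proof (rule ex1I)
    let ?\<phi> = "lin_ext sB g"
    note lin = B.linear_lin_ext[of g]
    have "?\<phi> (H_compos1 x y) = m1 (?\<phi> x) (?\<phi> y)" for x y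
      unfolding H_compos1_def
      by (rule multiplicative_on_basis[OF lin B.m1_linear_left B.m1_linear_right])
        (simp add: B.lin_ext_basis g)
    moreover have "?\<phi> (H_compos2 x y) = m2 (?\<phi> x) (?\<phi> y)" for x y
      unfolding H_compos2_def
      by (rule multiplicative_on_basis[OF lin B.m2_linear_left B.m2_linear_right])
        (simp add: B.lin_ext_basis g)
    ultimately show "?hom ?\<phi> \<and> (\<forall>x\<in>?S. ?\<phi> x = f x)"
      using lin by (auto simp: two_As_morphism_def B.lin_ext_basis g)
    fix \<psi>
    assume \<psi>: "?hom \<psi> \<and> (\<forall>x\<in>?S. \<psi> x = f x)"
    then have hom: "\<psi> (H_basis (pp_compos1 P Q)) = m1 (\<psi> (H_basis P)) (\<psi> (H_basis Q))"
      "\<psi> (H_basis (pp_compos2 P Q)) = m2 (\<psi> (H_basis P)) (\<psi> (H_basis Q))" for P Q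
      by (simp_all add: two_As_morphism_def bilinear_extension_basis[symmetric]
          H_compos1_def[symmetric] H_compos2_def[symmetric])
    have basis: "\<psi> (H_basis P) = g P" for P
      by (induction P rule: PP.generated_by_common_irreducibles)
        (use \<psi> in \<open>simp_all add: hom g two_As_morphism_def\<close>)
    have lin': "Vector_Spaces.linear H_scale sB \<psi>"
      using \<psi> by (simp add: two_As_morphism_def)
    show "\<psi> = ?\<phi>"
      by (rule ext, rule linear_eqI[OF lin' lin]) (simp add: B.lin_ext_basis basis)
  qed
qed

end
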